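(* For all $m,k,r\in\mathbb{N}$ with $k\ge r\ge 2$, there exists a bipartite graph $G$ with $$\mathrm{ch}_r(G)-\chi_r(G)\ge m,\qquad \chi_r(G)-\mathrm{ch}(G)\ge m,\qquad\text{and}\qquad \mathrm{ch}(G)\le k+1.$$
   Context: Graphs are finite and simple; $\mathbb{N}=\{1,2,\dots\}$. $N_G(v)$ is the set of neighbors of $v$ and $d_G(v)=|N_G(v)|$. The choice number $\mathrm{ch}(G)$ is the least $k$ such that for every assignment of sets (lists) $L(v)$ with $|L(v)|\ge k$ to the vertices $v\in V(G)$ there is a proper coloring $f$ of $G$ with $f(v)\in L(v)$ for all $v$. For $r\in\mathbb{N}$, an $r$-dynamic coloring of $G$ is a proper coloring $f$ such that $|f(N_G(v))|\ge\min\{r,d_G(v)\}$ for every vertex $v$. The $r$-dynamic chromatic number $\chi_r(G)$ is the least $k$ such that $G$ has an $r$-dynamic coloring from a set of $k$ colors. The $r$-dynamic choosability $\mathrm{ch}_r(G)$ is the least positive integer $k$ such that for every assignment of lists $L(v)$ with $|L(v)|\ge k$ to the vertices $v\in V(G)$ there is an $r$-dynamic coloring $f$ of $G$ with $f(v)\in L(v)$ for all $v\in V(G)$. *)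

theory Defs
  imports "Graph_Theory.Pair_Digraph"
begin

text \<open>
  Finite simple graphs are the library's \<^locale>\<open>pair_graph\<close>s: a finite vertex set
  \<^const>\<open>pverts\<close> together with a symmetric, irreflexive set \<^const>\<open>parcs\<close> of ordered
  pairs of vertices, each edge being represented by its two orientations.
\<close>

definition neighbors :: "'a pair_pre_digraph \<Rightarrow> 'a \<Rightarrow> 'a set" where
  "neighbors G v = {u. (v, u) \<in> parcs G}"

definition degree :: "'a pair_pre_digraph \<Rightarrow> 'a \<Rightarrow> nat" where
  "degree G v = card (neighbors G v)"

definition bipartite :: "'a pair_pre_digraph \<Rightarrow> bool" where
  "bipartite G \<longleftrightarrow>
    (\<exists>A B. A \<union> B = pverts G \<and> A \<inter> B = {} \<and> parcs G \<subseteq> A \<times> B \<union> B \<times> A)"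

text \<open>Only the values of a coloring on the vertices of the graph are relevant.\<close>

definition proper_coloring :: "'a pair_pre_digraph \<Rightarrow> ('a \<Rightarrow> 'c) \<Rightarrow> bool" where
  "proper_coloring G f \<longleftrightarrow> (\<forall>u v. (u, v) \<in> parcs G \<longrightarrow> f u \<noteq> f v)"

definition dynamic_coloring :: "nat \<Rightarrow> 'a pair_pre_digraph \<Rightarrow> ('a \<Rightarrow> 'c) \<Rightarrow> bool" where
  "dynamic_coloring r G f \<longleftrightarrow> proper_coloring G f \<and>
    (\<forall>v \<in> pverts G. card (f ` neighbors G v) \<ge> min r (degree G v))"

text \<open>
  Infinite lists satisfy every lower bound on the size, but have \<^const>\<open>card\<close> equal to 0.
\<close>

definition list_assignment :: "'a pair_pre_digraph \<Rightarrow> nat \<Rightarrow> ('a \<Rightarrow> 'c set) \<Rightarrow> bool" where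
  "list_assignment G k L \<longleftrightarrow> (\<forall>v \<in> pverts G. infinite (L v) \<or> card (L v) \<ge> k)"

text \<open>
  Colors are natural numbers, which is no restriction for finite graphs: lists may be shrunk to
  finite ones, and then only finitely many colors occur.  All three minima below range over
  nonempty sets of numbers when the graph is finite and simple, as an injective coloring is
  \<open>r\<close>-dynamic for every \<open>r\<close>, and one can be chosen from lists whose size is at least the number
  of vertices.
\<close>

definition choice_number :: "'a pair_pre_digraph \<Rightarrow> nat" where
  "choice_number G = (LEAST k. \<forall>L :: 'a \<Rightarrow> nat set. list_assignment G k L \<longrightarrow>
    (\<exists>f. proper_coloring G f \<and> (\<forall>v \<in> pverts G. f v \<in> L v)))"

definition dynamic_chromatic_number :: "nat \<Rightarrow> 'a pair_pre_digraph \<Rightarrow> nat" where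
  "dynamic_chromatic_number r G = (LEAST k. \<exists>C :: nat set. finite C \<and> card C = k \<and>
    (\<exists>f. dynamic_coloring r G f \<and> (\<forall>v \<in> pverts G. f v \<in> C)))"

definition dynamic_choosability :: "nat \<Rightarrow> 'a pair_pre_digraph \<Rightarrow> nat" where
  "dynamic_choosability r G = (LEAST k. k > 0 \<and> (\<forall>L :: 'a \<Rightarrow> nat set. list_assignment G k L \<longrightarrow>
    (\<exists>f. dynamic_coloring r G f \<and> (\<forall>v \<in> pverts G. f v \<in> L v))))"

end

theory Submission
  imports Defs "HOL-Library.Nat_Bijection"
begin

text \<open>
  Let \<open>G\<close> arise from a graph \<open>H\<close> by replacing each edge with two paths of length two, one for each
  orientation.  Three facts about \<open>G\<close> make it useful.  It is bipartite.  Its choice number is at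
  most 3 (\<open>choice_number_subdivision\<close>), whatever \<open>H\<close> is: the old vertices form an independent set
  and can be colored arbitrarily, after which each new vertex has only two colors to avoid.
  Finally, for \<open>r \<ge> 2\<close>, an \<open>r\<close>-dynamic coloring must show two different colors around each new
  vertex, that is, at the two ends of each edge of \<open>H\<close>; so its restriction to the old vertices is a
  proper coloring of \<open>H\<close>.  Consequently the \<open>r\<close>-dynamic chromatic number of \<open>G\<close> is at least the
  chromatic number of \<open>H\<close>, and its \<open>r\<close>-dynamic choosability is at least the choice number of \<open>H\<close>
  (\<open>dynamic_choosability_subdivision\<close>).

  It remains to choose \<open>H\<close> with large chromatic number and a much larger choice number, while
  keeping the \<open>r\<close>-dynamic chromatic number of \<open>G\<close> under control.  Complete multipartite graphs with
  \<open>n = r + m + 3\<close> parts do this.  Their chromatic number is \<open>n\<close>, so the \<open>r\<close>-dynamic chromatic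
  number of \<open>G\<close> exceeds 3 by at least \<open>m\<close>; and that number is at most \<open>2 * n\<close>, by using
  \<open>n\<close> further colors on the new vertices (\<open>dynamic_coloring_subdivision\<close>).
  Neither bound depends on the size of the parts, whereas the choice number is unbounded as the parts grow (\<open>multipartite_not_choosable\<close>), so it can be made larger
  than \<open>2 * n + m\<close>.
\<close>

section \<open>Graphs and lists\<close>

lemma pair_graphI:
  assumes "finite (pverts G)" "parcs G \<subseteq> pverts G \<times> pverts G"
    and "sym (parcs G)" "\<And>u. (u, u) \<notin> parcs G"
  shows "pair_graph G"
proof
  show "finite (parcs G)" using assms(1,2) by (meson finite_SigmaI finite_subset)
  show "symmetric G" using assms(3) by (simp add: symmetric_def)
qed (use assms in auto)

lemma pair_graphD:
  assumes "pair_graph G"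
  shows "finite (pverts G)" "(u, v) \<in> parcs G \<Longrightarrow> u \<in> pverts G"
    "(u, v) \<in> parcs G \<Longrightarrow> v \<in> pverts G" "(u, v) \<in> parcs G \<Longrightarrow> (v, u) \<in> parcs G"
    "(u, u) \<notin> parcs G"
proof -
  interpret pair_graph G by fact
  show "finite (pverts G)" by (rule pair_finite_verts)
  show "(u, v) \<in> parcs G \<Longrightarrow> u \<in> pverts G" "(u, v) \<in> parcs G \<Longrightarrow> v \<in> pverts G"
    by (auto dest: in_arcsD1 in_arcsD2)
  show "(u, v) \<in> parcs G \<Longrightarrow> (v, u) \<in> parcs G"
    using pair_sym_arcs by (simp add: symmetric_def sym_def)
  show "(u, u) \<notin> parcs G" using pair_no_loops by force
qed

lemma exists_notin_small:
  assumes "finite S" "card S < k" "infinite A \<or> k \<le> card A"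
  shows "\<exists>x\<in>A. x \<notin> S"
  using assms by (metis card_mono finite_subset leD le_less_trans subsetI)

lemma injective_choice:
  assumes "finite A" "\<forall>a\<in>A. infinite (L a) \<or> card A \<le> card (L a)"
  shows "\<exists>f. inj_on f A \<and> (\<forall>a\<in>A. f a \<in> L a)"
  using assms
proof (induction A)
  case empty
  then show ?case by simp
next
  case (insert a A)
  then obtain f where f: "inj_on f A" "\<forall>b\<in>A. f b \<in> L b"
    by force
  have "card (f ` A) < card (insert a A)"
    using insert.hyps card_image_le[of A f] by simp
  then obtain x where x: "x \<in> L a" "x \<notin> f ` A"
    using exists_notin_small[of "f ` A" "card (insert a A)" "L a"] insert by auto
  have "inj_on (f(a := x)) (insert a A)"
    using f(1) x(2) insert.hyps(2) by (auto simp: inj_on_def)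
  moreover have "\<forall>b\<in>insert a A. (f(a := x)) b \<in> L b"
    using f(2) x(1) insert.hyps(2) by auto
  ultimately show ?case by blast
qed

lemma injective_imp_dynamic_coloring:
  assumes G: "pair_graph G" and f: "inj_on f (pverts G)"
  shows "dynamic_coloring r G f"
proof -
  have "neighbors G v \<subseteq> pverts G" for v
    using pair_graphD(3)[OF G] by (auto simp: neighbors_def)
  then have "card (f ` neighbors G v) = degree G v" for v
    using f by (metis card_image degree_def inj_on_subset)
  moreover have "f u \<noteq> f v" if "(u, v) \<in> parcs G" for u v
    using that f pair_graphD(2,3,5)[OF G] by (metis inj_onD)
  ultimately show ?thesis
    by (auto simp: dynamic_coloring_def proper_coloring_def)
qed

text \<open>
  The least number in the definition of the \<open>r\<close>-dynamic choosability is attained because lists as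
  large as the vertex set admit injective colorings.  Given that, a bad assignment of lists of size
  \<open>s\<close> excludes every number up to \<open>s\<close>.
\<close>

lemma dynamic_choosability_greater:
  fixes L :: "'a \<Rightarrow> nat set"
  assumes G: "pair_graph G" and L: "list_assignment G s L"
    and bad: "\<not> (\<exists>f. dynamic_coloring r G f \<and> (\<forall>v\<in>pverts G. f v \<in> L v))"
  shows "s < dynamic_choosability r G"
proof -
  let ?P = "\<lambda>k. k > 0 \<and> (\<forall>L :: 'a \<Rightarrow> nat set. list_assignment G k L \<longrightarrow>
    (\<exists>f. dynamic_coloring r G f \<and> (\<forall>v \<in> pverts G. f v \<in> L v)))"
  have "?P (Suc (card (pverts G)))"
  proof (intro conjI allI impI)
    fix L :: "'a \<Rightarrow> nat set"
    assume "list_assignment G (Suc (card (pverts G))) L"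
    then have "\<forall>v\<in>pverts G. infinite (L v) \<or> card (pverts G) \<le> card (L v)"
      by (auto simp: list_assignment_def)
    then show "\<exists>f. dynamic_coloring r G f \<and> (\<forall>v\<in>pverts G. f v \<in> L v)"
      using injective_choice[OF pair_graphD(1)[OF G]] injective_imp_dynamic_coloring[OF G]
      by metis
  qed simp
  then have P: "?P (dynamic_choosability r G)"
    unfolding dynamic_choosability_def by (rule LeastI)
  show ?thesis
  proof (rule ccontr)
    assume "\<not> s < dynamic_choosability r G"
    then have "list_assignment G (dynamic_choosability r G) L"
      using L by (fastforce simp: list_assignment_def)
    then show False using P bad by blast
  qed
qed

section \<open>Subdivisions\<close>

text \<open>
  The diagonal of the pairing function carries the old vertices; as graphs have no loops, it is
  disjoint from the codes of arcs, which serve as the new vertices.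
\<close>

definition branch :: "nat \<Rightarrow> nat" where
  "branch u = prod_encode (u, u)"

definition subdivision :: "nat pair_pre_digraph \<Rightarrow> nat pair_pre_digraph" where
  "subdivision H = (let I = {(branch u, prod_encode e) | u e.
      e \<in> parcs H \<and> (u = fst e \<or> u = snd e)} in
    \<lparr>pverts = branch ` pverts H \<union> prod_encode ` parcs H, parcs = I \<union> I\<inverse>\<rparr>)"

lemma pverts_subdivision: "pverts (subdivision H) = branch ` pverts H \<union> prod_encode ` parcs H"
  by (simp add: subdivision_def Let_def)

lemma parcs_subdivision:
  "(x, y) \<in> parcs (subdivision H) \<longleftrightarrow>
    (\<exists>u v w. (u, v) \<in> parcs H \<and> (w = u \<or> w = v) \<and>
      (x = branch w \<and> y = prod_encode (u, v) \<or> y = branch w \<and> x = prod_encode (u, v)))"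
  by (auto simp: subdivision_def Let_def)

lemma branch_eq_iff: "branch u = branch v \<longleftrightarrow> u = v"
  by (simp add: branch_def)

lemma branch_neq_arc: "pair_graph H \<Longrightarrow> (u, v) \<in> parcs H \<Longrightarrow> branch w \<noteq> prod_encode (u, v)"
  using pair_graphD(5)[of H u] by (auto simp: branch_def)

lemma pair_graph_subdivision:
  assumes H: "pair_graph H"
  shows "pair_graph (subdivision H)"
proof (rule pair_graphI)
  have "finite (parcs H)"
    using H by (simp add: pair_fin_digraph.pair_finite_arcs pair_digraph_def pair_graph_def)
  then show "finite (pverts (subdivision H))"
    using pair_graphD(1)[OF H] by (simp add: pverts_subdivision)
  show "parcs (subdivision H) \<subseteq> pverts (subdivision H) \<times> pverts (subdivision H)"
    using pair_graphD(2,3)[OF H] by (auto simp: pverts_subdivision parcs_subdivision)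
  show "sym (parcs (subdivision H))"
    unfolding sym_def parcs_subdivision by blast
  show "(x, x) \<notin> parcs (subdivision H)" for x
    using branch_neq_arc[OF H] by (auto simp: parcs_subdivision)
qed

lemma bipartite_subdivision:
  assumes H: "pair_graph H"
  shows "bipartite (subdivision H)"
  unfolding bipartite_def
proof (intro exI conjI)
  show "branch ` pverts H \<union> prod_encode ` parcs H = pverts (subdivision H)"
    by (simp add: pverts_subdivision)
  show "branch ` pverts H \<inter> prod_encode ` parcs H = {}"
    using branch_neq_arc[OF H] by auto
  show "parcs (subdivision H) \<subseteq> branch ` pverts H \<times> prod_encode ` parcs H \<union>
      prod_encode ` parcs H \<times> branch ` pverts H"
    using pair_graphD(2,3)[OF H] by (auto simp: parcs_subdivision)
qed

lemma neighbors_subdivision_arc: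
  assumes H: "pair_graph H" and e: "(u, v) \<in> parcs H"
  shows "neighbors (subdivision H) (prod_encode (u, v)) = {branch u, branch v}"
  using e branch_neq_arc[OF H e] branch_neq_arc[OF H e, symmetric]
  by (auto simp: neighbors_def parcs_subdivision)

lemma neighbors_subdivision_branch:
  assumes "pair_graph H" "(u, v) \<in> parcs H"
  shows "prod_encode (u, v) \<in> neighbors (subdivision H) (branch u)"
  using assms by (auto simp: neighbors_def parcs_subdivision)

text \<open>
  Every neighbor of a new vertex is an old one, so coloring the old vertices arbitrarily leaves
  at most two forbidden colors for each new vertex.
\<close>

lemma choice_number_subdivision:
  assumes H: "pair_graph H"
  shows "choice_number (subdivision H) \<le> 3"
  unfolding choice_number_def
proof (intro Least_le allI impI)
  fix L :: "nat \<Rightarrow> nat set"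
  assume L: "list_assignment (subdivision H) 3 L"
  define g where "g x = (SOME c. c \<in> L x)" for x
  define f where "f x = (case prod_decode x of (u, v) \<Rightarrow>
    if u = v then g x else SOME c. c \<in> L x \<and> c \<notin> {g (branch u), g (branch v)})" for x
  have f_branch: "f (branch u) = g (branch u)" for u
    by (simp add: f_def branch_def)
  have branch: "f (branch u) \<in> L (branch u)" if "u \<in> pverts H" for u
  proof -
    have "\<exists>c\<in>L (branch u). c \<notin> {}"
      using that L
      by (intro exists_notin_small[where k = 3]) (auto simp: list_assignment_def pverts_subdivision)
    then show ?thesis unfolding f_branch g_def by (auto intro: someI)
  qed
  have arc: "f (prod_encode (u, v)) \<in> L (prod_encode (u, v)) \<and>
      f (prod_encode (u, v)) \<notin> {g (branch u), g (branch v)}" if e: "(u, v) \<in> parcs H" for u v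
  proof -
    have "card {g (branch u), g (branch v)} < 3"
      by (simp add: card_insert_if)
    then have "\<exists>c\<in>L (prod_encode (u, v)). c \<notin> {g (branch u), g (branch v)}"
      using e L
      by (intro exists_notin_small[where k = 3]) (auto simp: list_assignment_def pverts_subdivision)
    then have "\<exists>c. c \<in> L (prod_encode (u, v)) \<and> c \<notin> {g (branch u), g (branch v)}"
      by blast
    from someI_ex[OF this] show ?thesis
      using e pair_graphD(5)[OF H] by (auto simp: f_def)
  qed
  have "proper_coloring (subdivision H) f"
    unfolding proper_coloring_def parcs_subdivision
    using arc f_branch by (metis insertCI)
  moreover have "\<forall>x\<in>pverts (subdivision H). f x \<in> L x"
    using branch arc by (auto simp: pverts_subdivision)
  ultimately show "\<exists>f. proper_coloring (subdivision H) f \<and>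
      (\<forall>x\<in>pverts (subdivision H). f x \<in> L x)"
    by blast
qed

text \<open>The two ends of an arc are the two neighbors of its new vertex, which must see two colors.\<close>

lemma dynamic_coloring_subdivision_restrict:
  assumes H: "pair_graph H" and r: "r \<ge> 2" and f: "dynamic_coloring r (subdivision H) f"
  shows "proper_coloring H (\<lambda>u. f (branch u))"
  unfolding proper_coloring_def
proof (intro allI impI)
  fix u v assume e: "(u, v) \<in> parcs H"
  then have "u \<noteq> v" using pair_graphD(5)[OF H] by auto
  then have "degree (subdivision H) (prod_encode (u, v)) = 2"
    by (simp add: degree_def neighbors_subdivision_arc[OF H e] branch_eq_iff)
  moreover have "prod_encode (u, v) \<in> pverts (subdivision H)"
    using e by (simp add: pverts_subdivision)
  ultimately have "card (f ` {branch u, branch v}) \<ge> 2"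
    using f r by (force simp: dynamic_coloring_def neighbors_subdivision_arc[OF H e])
  then show "f (branch u) \<noteq> f (branch v)" by (auto simp: card_insert_if split: if_splits)
qed

lemma dynamic_choosability_subdivision:
  fixes L :: "nat \<Rightarrow> nat set"
  assumes H: "pair_graph H" and r: "r \<ge> 2" and L: "list_assignment H s L"
    and bad: "\<not> (\<exists>f. proper_coloring H f \<and> (\<forall>v\<in>pverts H. f v \<in> L v))"
  shows "s < dynamic_choosability r (subdivision H)"
proof (rule dynamic_choosability_greater[OF pair_graph_subdivision[OF H]])
  let ?L = "\<lambda>x. case prod_decode x of (u, v) \<Rightarrow> if u = v then L u else UNIV"
  have branch: "?L (branch u) = L u" for u by (simp add: branch_def)
  have "infinite (?L x) \<or> s \<le> card (?L x)" if "x \<in> pverts (subdivision H)" for x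
    using that L pair_graphD(5)[OF H]
    by (auto simp: pverts_subdivision list_assignment_def branch_def)
  then show "list_assignment (subdivision H) s ?L"
    unfolding list_assignment_def by blast
  show "\<not> (\<exists>f. dynamic_coloring r (subdivision H) f \<and> (\<forall>x\<in>pverts (subdivision H). f x \<in> ?L x))"
  proof
    assume "\<exists>f. dynamic_coloring r (subdivision H) f \<and> (\<forall>x\<in>pverts (subdivision H). f x \<in> ?L x)"
    then obtain f where f: "dynamic_coloring r (subdivision H) f"
      and fL: "\<forall>x\<in>pverts (subdivision H). f x \<in> ?L x" by blast
    have "f (branch u) \<in> L u" if "u \<in> pverts H" for u
    proof -
      have "branch u \<in> pverts (subdivision H)" using that by (simp add: pverts_subdivision)
      then have "f (branch u) \<in> ?L (branch u)" by (rule fL[rule_format])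
      then show ?thesis unfolding branch .
    qed
    then show False
      using bad dynamic_coloring_subdivision_restrict[OF H r f] by blast
  qed
qed

text \<open>
  A second copy of the colors is used on the new vertices: the one for the arc \<open>(u, v)\<close> takes the
  copy of the color of \<open>v\<close>.  Then \<open>u\<close> sees a copy of each color that it sees in \<open>H\<close>.
  The hypothesis asks for \<open>r\<close> colors even when \<open>u\<close> has fewer neighbors, because its degree is
  twice as large in the subdivision.
\<close>

lemma dynamic_coloring_subdivision:
  fixes c :: "nat \<Rightarrow> nat"
  assumes H: "pair_graph H" and c: "proper_coloring H c" and n: "\<forall>v\<in>pverts H. c v < n"
    and r: "\<forall>v\<in>pverts H. r \<le> card (c ` neighbors H v)"
  shows "\<exists>f. dynamic_coloring r (subdivision H) f \<and> (\<forall>x\<in>pverts (subdivision H). f x \<in> {..<2 * n})"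
proof -
  define f where "f x = (case prod_decode x of (u, v) \<Rightarrow> if u = v then c u else n + c v)" for x
  have branch: "f (branch u) = c u" for u by (simp add: f_def branch_def)
  have arc: "f (prod_encode (u, v)) = n + c v" if "(u, v) \<in> parcs H" for u v
    using that pair_graphD(5)[OF H] by (auto simp: f_def)
  have "f x \<noteq> f y" if xy: "(x, y) \<in> parcs (subdivision H)" for x y
  proof -
    obtain u v w where e: "(u, v) \<in> parcs H" "w = u \<or> w = v"
      and xy: "x = branch w \<and> y = prod_encode (u, v) \<or> y = branch w \<and> x = prod_encode (u, v)"
      using xy unfolding parcs_subdivision by blast
    have "c w < n" using e n pair_graphD(2,3)[OF H] by blast
    then show ?thesis using xy arc[OF e(1)] by (auto simp: branch)
  qed
  then have proper: "proper_coloring (subdivision H) f" by (simp add: proper_coloring_def)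
  have "card (f ` neighbors (subdivision H) x) \<ge> min r (degree (subdivision H) x)"
    if "x \<in> pverts (subdivision H)" for x
  proof -
    have "r \<le> card (f ` neighbors (subdivision H) (branch u))" if u: "u \<in> pverts H" for u
    proof -
      have "finite (neighbors (subdivision H) (branch u))"
        using pair_graphD(1,3)[OF pair_graph_subdivision[OF H]]
        by (auto simp: neighbors_def intro: finite_subset)
      moreover have "(\<lambda>i. n + i) ` c ` neighbors H u \<subseteq> f ` neighbors (subdivision H) (branch u)"
      proof
        fix i assume "i \<in> (\<lambda>i. n + i) ` c ` neighbors H u"
        then obtain v where e: "(u, v) \<in> parcs H" and i: "i = n + c v"
          by (auto simp: neighbors_def)
        show "i \<in> f ` neighbors (subdivision H) (branch u)"
          unfolding i arc[OF e, symmetric]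
          by (intro imageI neighbors_subdivision_branch[OF H e])
      qed
      ultimately have "card ((\<lambda>i. n + i) ` c ` neighbors H u)
          \<le> card (f ` neighbors (subdivision H) (branch u))"
        by (intro card_mono finite_imageI)
      then show ?thesis using r u by (force simp: card_image)
    qed
    moreover have "degree (subdivision H) (prod_encode (u, v)) =
        card (f ` neighbors (subdivision H) (prod_encode (u, v)))" if e: "(u, v) \<in> parcs H" for u v
    proof -
      have "c u \<noteq> c v" using c e by (auto simp: proper_coloring_def)
      then show ?thesis
        by (auto simp: degree_def neighbors_subdivision_arc[OF H e] branch card_insert_if branch_eq_iff)
    qed
    ultimately show ?thesis using that by (auto simp: pverts_subdivision intro: min.coboundedI1)
  qed
  moreover have "\<forall>x\<in>pverts (subdivision H). f x \<in> {..<2 * n}"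
    using n arc pair_graphD(3)[OF H] by (auto simp: pverts_subdivision branch)
  ultimately show ?thesis using proper by (auto simp: dynamic_coloring_def)
qed

section \<open>Complete multipartite graphs\<close>

definition multipartite :: "nat \<Rightarrow> nat \<Rightarrow> nat pair_pre_digraph" where
  "multipartite n N = \<lparr>pverts = {..<n * N},
    parcs = {(u, v). u < n * N \<and> v < n * N \<and> u mod n \<noteq> v mod n}\<rparr>"

lemma pair_graph_multipartite: "pair_graph (multipartite n N)"
  by (rule pair_graphI) (auto simp: multipartite_def sym_def)

lemma multipartite_vertex:
  assumes "i < n" "j < N"
  shows "n * j + i \<in> pverts (multipartite n N)" "(n * j + i) mod n = i" "(n * j + i) div n = j"
proof -
  have "n * j + i < n * Suc j" using assms by simp
  also have "\<dots> \<le> n * N" using assms by (intro mult_le_mono2) simp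
  finally show "n * j + i \<in> pverts (multipartite n N)" by (simp add: multipartite_def)
qed (use assms in auto)

lemma multipartite_adjacent:
  assumes "i < n" "i' < n" "i \<noteq> i'" "j < N" "j' < N"
  shows "(n * j + i, n * j' + i') \<in> parcs (multipartite n N)"
  using assms multipartite_vertex[of i n j N] multipartite_vertex[of i' n j' N]
  by (auto simp: multipartite_def)

lemma multipartite_proper_coloring_card:
  assumes f: "proper_coloring (multipartite n N) f" and N: "N > 0"
    and C: "finite C" "\<forall>v\<in>pverts (multipartite n N). f v \<in> C"
  shows "n \<le> card C"
proof -
  have "inj_on f {..<n}"
  proof (rule inj_onI, rule ccontr)
    fix i j assume "i \<in> {..<n}" "j \<in> {..<n}" "f i = f j" "i \<noteq> j"
    then show False
      using f multipartite_adjacent[of i n j 0 N 0] N by (auto simp: proper_coloring_def)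
  qed
  moreover have "f ` {..<n} \<subseteq> C"
    using C(2) multipartite_vertex(1)[of _ n 0 N] N by auto
  ultimately show ?thesis using card_inj_on_le[OF _ _ C(1), of f "{..<n}"] by simp
qed

lemma multipartite_part_coloring:
  fixes n N :: nat
  assumes "n > 0"
  shows "proper_coloring (multipartite n N) (\<lambda>v. v mod n)"
    and "v \<in> pverts (multipartite n N) \<Longrightarrow>
      card ((\<lambda>v. v mod n) ` neighbors (multipartite n N) v) \<ge> n - 1"
proof -
  show "proper_coloring (multipartite n N) (\<lambda>v. v mod n)"
    by (auto simp: proper_coloring_def multipartite_def)
  assume v: "v \<in> pverts (multipartite n N)"
  then have N: "N > 0" by (cases N) (auto simp: multipartite_def)
  have "{..<n} - {v mod n} \<subseteq> (\<lambda>v. v mod n) ` neighbors (multipartite n N) v"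
  proof
    fix i assume i: "i \<in> {..<n} - {v mod n}"
    then have "i \<in> neighbors (multipartite n N) v" "i = i mod n"
      using v multipartite_vertex(1)[of i n 0 N] N by (auto simp: neighbors_def multipartite_def)
    then show "i \<in> (\<lambda>v. v mod n) ` neighbors (multipartite n N) v" by blast
  qed
  moreover have "finite (neighbors (multipartite n N) v)"
    by (rule finite_subset[of _ "{..<n * N}"]) (auto simp: neighbors_def multipartite_def)
  ultimately have "card ({..<n} - {v mod n}) \<le> card ((\<lambda>v. v mod n) ` neighbors (multipartite n N) v)"
    by (intro card_mono finite_imageI)
  then show "card ((\<lambda>v. v mod n) ` neighbors (multipartite n N) v) \<ge> n - 1"
    using assms by simp
qed

text \<open>
  Take as lists in each part all \<open>s\<close>-element subsets of a set of \<open>2 * s - 1\<close> colors.  The colors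
  used on a part meet each such subset, so fewer than \<open>s\<close> colors are missing there and at least \<open>s\<close>
  are used.  Two parts use disjoint sets of colors, hence at least \<open>2 * s\<close> colors altogether.
\<close>

lemma multipartite_not_choosable:
  assumes n: "n \<ge> 2" and s: "s > 0"
  shows "\<exists>N > 0. \<exists>L :: nat \<Rightarrow> nat set. list_assignment (multipartite n N) s L \<and>
    \<not> (\<exists>f. proper_coloring (multipartite n N) f \<and> (\<forall>v\<in>pverts (multipartite n N). f v \<in> L v))"
proof -
  define X where "X = {..<2 * s - 1}"
  define F where "F = {S. S \<subseteq> X \<and> card S = s}"
  have finX: "finite X" by (simp add: X_def)
  have finF: "finite F" unfolding F_def by (rule finite_subset[of _ "Pow X"]) (auto simp: finX)
  have "{..<s} \<in> F" using s by (auto simp: F_def X_def)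
  then have N: "card F > 0" using finF by (auto simp: card_gt_0_iff)
  obtain e where e: "bij_betw e {0..<card F} F"
    using ex_bij_betw_nat_finite[OF finF] by blast
  \<comment> \<open>\<open>v mod n\<close> is the part of \<open>v\<close> and \<open>v div n\<close> its position there, so each part receives
    every list once.\<close>
  define L where "L v = e (v div n)" for v
  let ?H = "multipartite n (card F)"
  have LF: "L v \<in> F" if v: "v \<in> pverts ?H" for v
  proof -
    have "v div n < card F"
      using v by (simp add: multipartite_def less_mult_imp_div_less mult.commute)
    then show ?thesis using e by (auto simp: L_def bij_betw_def)
  qed
  have False if f: "proper_coloring ?H f" and fL: "\<forall>v\<in>pverts ?H. f v \<in> L v" for f
  proof -
    define U where "U i = f ` {v \<in> pverts ?H. v mod n = i}" for i
    have UX: "U i \<subseteq> X" for i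
      using LF fL by (force simp: U_def F_def)
    have large: "s \<le> card (U i)" if i: "i < n" for i
    proof (rule ccontr)
      assume "\<not> s \<le> card (U i)"
      then have "s \<le> card (X - U i)"
        using UX[of i] finX by (simp add: card_Diff_subset finite_subset X_def)
      then obtain S where S: "S \<subseteq> X - U i" "card S = s"
        by (meson obtain_subset_with_card_n)
      then have "S \<in> e ` {0..<card F}"
        using bij_betw_imp_surj_on[OF e] by (auto simp: F_def)
      then obtain j where j: "j < card F" "e j = S" by auto
      have "f (n * j + i) \<in> S"
        using fL multipartite_vertex[OF i j(1)] j(2) by (metis L_def)
      moreover have "f (n * j + i) \<in> U i"
        using multipartite_vertex[OF i j(1)] by (auto simp: U_def)
      ultimately show False using S(1) by blast
    qed
    have "U 0 \<inter> U 1 = {}"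
    proof (rule ccontr)
      assume "U 0 \<inter> U 1 \<noteq> {}"
      then obtain c where "c \<in> U 0" "c \<in> U 1" by blast
      then obtain u v where "u \<in> pverts ?H" "u mod n = 0" "f u = c"
        and "v \<in> pverts ?H" "v mod n = 1" "f v = c"
        unfolding U_def by (elim imageE CollectE conjE) metis
      then have "(u, v) \<in> parcs ?H" "f u = f v" by (simp_all add: multipartite_def)
      then show False using f[unfolded proper_coloring_def, rule_format, of u v] by simp
    qed
    then have "card (U 0) + card (U 1) = card (U 0 \<union> U 1)"
      using UX finX by (intro card_Un_disjoint[symmetric]) (auto intro: finite_subset)
    also have "\<dots> \<le> card X" using UX finX by (intro card_mono) auto
    finally show False using large[of 0] large[of 1] n s by (simp add: X_def)
  qed
  moreover have "list_assignment ?H s L"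
    using LF by (auto simp: list_assignment_def F_def)
  ultimately show ?thesis using N by blast
qed

section \<open>Separating the three parameters\<close>

theorem theorem2p2:
  fixes m k r :: nat
  assumes "m \<ge> 1" and "k \<ge> r" and "r \<ge> 2"
  shows "\<exists>G :: nat pair_pre_digraph. pair_graph G \<and> bipartite G \<and>
    int (dynamic_choosability r G) - int (dynamic_chromatic_number r G) \<ge> int m \<and>
    int (dynamic_chromatic_number r G) - int (choice_number G) \<ge> int m \<and>
    choice_number G \<le> k + 1"
proof -
  \<comment> \<open>At least \<open>m + 3\<close> parts separate the dynamic chromatic number from 3, and more than \<open>r\<close> parts
    let each vertex see at least \<open>r\<close> other parts.\<close>
  define n where "n = r + m + 3"
  obtain N and L :: "nat \<Rightarrow> nat set" where N: "N > 0"
    and L: "list_assignment (multipartite n N) (2 * n + m) L"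
    and bad: "\<not> (\<exists>f. proper_coloring (multipartite n N) f \<and>
      (\<forall>v\<in>pverts (multipartite n N). f v \<in> L v))"
    using multipartite_not_choosable[of n "2 * n + m"] unfolding n_def by auto
  let ?H = "multipartite n N"
  let ?G = "subdivision ?H"
  note H = pair_graph_multipartite[of n N]
  have ch: "choice_number ?G \<le> 3" by (rule choice_number_subdivision[OF H])
  have ch_r: "2 * n + m < dynamic_choosability r ?G"
    by (rule dynamic_choosability_subdivision[OF H \<open>r \<ge> 2\<close> L bad])
  let ?P = "\<lambda>k. \<exists>C :: nat set. finite C \<and> card C = k \<and>
    (\<exists>f. dynamic_coloring r ?G f \<and> (\<forall>v \<in> pverts ?G. f v \<in> C))"
  have "\<forall>v\<in>pverts ?H. r \<le> card ((\<lambda>v. v mod n) ` neighbors ?H v)"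
    using multipartite_part_coloring(2)[of n _ N] by (force simp: n_def)
  then have "\<exists>f. dynamic_coloring r ?G f \<and> (\<forall>v \<in> pverts ?G. f v \<in> {..<2 * n})"
    by (intro dynamic_coloring_subdivision[OF H multipartite_part_coloring(1)])
      (auto simp: n_def)
  then have P: "?P (2 * n)" by (intro exI[of _ "{..<2 * n}"]) simp
  then have upper: "dynamic_chromatic_number r ?G \<le> 2 * n"
    unfolding dynamic_chromatic_number_def by (rule Least_le)
  have "?P (dynamic_chromatic_number r ?G)"
    using P unfolding dynamic_chromatic_number_def by (rule LeastI)
  then obtain C :: "nat set" and f where C: "finite C" "card C = dynamic_chromatic_number r ?G"
    and f: "dynamic_coloring r ?G f" "\<forall>v \<in> pverts ?G. f v \<in> C"
    by blast
  have lower: "n \<le> dynamic_chromatic_number r ?G"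
    using multipartite_proper_coloring_card
        [OF dynamic_coloring_subdivision_restrict[OF H \<open>r \<ge> 2\<close> f(1)] N C(1)] C(2) f(2)
    by (auto simp: pverts_subdivision)
  show ?thesis
  proof (intro exI conjI)
    show "pair_graph ?G" by (rule pair_graph_subdivision[OF H])
    show "bipartite ?G" by (rule bipartite_subdivision[OF H])
    show "int (dynamic_choosability r ?G) - int (dynamic_chromatic_number r ?G) \<ge> int m"
      using ch_r upper by linarith
    show "int (dynamic_chromatic_number r ?G) - int (choice_number ?G) \<ge> int m"
      using ch lower by (simp add: n_def)
    show "choice_number ?G \<le> k + 1" using ch assms by linarith
  qed
qed

end
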